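(* Let $G$ be a finitely presentable discrete group and $\mathcal{A}=\mathbb{C}[G]$ its group algebra. A linear operator $X\colon\mathcal{A}\to\mathcal{A}$ is a derivation if and only if the associated function $T^{X}$ on the morphisms of the groupoid $\mathcal{G}$ of the adjoint action of $G$ satisfies $$T^{X}(\eta*\xi)=T^{X}(\eta)+T^{X}(\xi)$$ for every pair of morphisms $\xi,\eta\in\mathrm{Mor}(\mathcal{G})$ for which the composition $\eta*\xi$ is defined.
   Context: A derivation of $\mathcal{A}$ is a linear operator $X\colon\mathcal{A}\to\mathcal{A}$ with $X(uv)=X(u)v+uX(v)$ for all $u,v\in\mathcal{A}$. The groupoid $\mathcal{G}$ of the adjoint action has object set $\mathrm{Obj}(\mathcal{G})=G$ and, for $a,b\in G$, $\mathrm{Mor}(a,b)=\{g\in G: ga=bg\}$, i.e. those $g$ with $b=gag^{-1}$. An element of $\mathrm{Mor}(a,b)$ is written $\left(\frac{a\to b}{g}\right)$, and $\mathrm{Mor}(\mathcal{G})=\coprod_{a,b\in G}\mathrm{Mor}(a,b)$. If $\xi=\left(\frac{a\to b}{g_1}\right)$ and $\eta=\left(\frac{b\to c}{g_2}\right)$, the composition is $\eta*\xi=\left(\frac{a\to c}{g_2g_1}\right)$. A linear operator $X\colon\mathcal{A}\to\mathcal{A}$ has matrix $\|x^{h}_{g}\|_{g,h\in G}$ defined by $X(g)=\sum_{h\in G}x^{h}_{g}\cdot h$ (a finite sum for each $g\in G$). The function $T^{X}\colon\mathrm{Mor}(\mathcal{G})\to\mathbb{C}$ associated with $X$ is $T^{X}\left(\frac{a\to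 b}{g}\right)=x^{h}_{g}$, where $h=ga=bg$. *)

theory Defs
  imports "HOL-Library.Poly_Mapping" "HOL-Algebra.Coset" Complex_Main
begin

section \<open>Free groups and finite presentability\<close>

text \<open>A letter \<open>(True, x)\<close> stands for the generator \<open>x\<close>, and \<open>(False, x)\<close> for its formal inverse.\<close>

type_synonym 'x word = "(bool \<times> 'x) list"

definition words_on :: "'x set \<Rightarrow> 'x word set"
  where "words_on S = lists (UNIV \<times> S)"

definition inverse_word :: "'x word \<Rightarrow> 'x word"
  where "inverse_word w = rev (map (\<lambda>(s, x). (\<not> s, x)) w)"

inductive_set free_rel :: "'x set \<Rightarrow> ('x word \<times> 'x word) set"
  for S :: "'x set"
  where
    refl: "u \<in> words_on S \<Longrightarrow> (u, u) \<in> free_rel S"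
  | sym: "(u, v) \<in> free_rel S \<Longrightarrow> (v, u) \<in> free_rel S"
  | trans: "(u, v) \<in> free_rel S \<Longrightarrow> (v, w) \<in> free_rel S \<Longrightarrow> (u, w) \<in> free_rel S"
  | cancel: "u \<in> words_on S \<Longrightarrow> v \<in> words_on S \<Longrightarrow> x \<in> S \<Longrightarrow>
      (u @ [(s, x), (\<not> s, x)] @ v, u @ v) \<in> free_rel S"

definition free_group :: "'x set \<Rightarrow> 'x word set monoid"
  where "free_group S =
    \<lparr>carrier = words_on S // free_rel S,
     mult = (\<lambda>A B. \<Union>u\<in>A. \<Union>v\<in>B. free_rel S `` {u @ v}),
     one = free_rel S `` {[]}\<rparr>"

lemma words_on_append [simp]: "u @ v \<in> words_on S \<longleftrightarrow> u \<in> words_on S \<and> v \<in> words_on S"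
  by (auto simp: words_on_def)

lemma words_on_Nil [simp]: "[] \<in> words_on S"
  by (simp add: words_on_def)

lemma words_on_Cons [simp]: "(s, x) # w \<in> words_on S \<longleftrightarrow> x \<in> S \<and> w \<in> words_on S"
  by (auto simp: words_on_def)

lemma inverse_word_simps [simp]:
  "inverse_word [] = []"
  "inverse_word ((s, x) # w) = inverse_word w @ [(\<not> s, x)]"
  by (simp_all add: inverse_word_def)

lemma inverse_word_in [simp]: "w \<in> words_on S \<Longrightarrow> inverse_word w \<in> words_on S"
  by (induction w) auto

lemma free_rel_words: "(u, v) \<in> free_rel S \<Longrightarrow> u \<in> words_on S \<and> v \<in> words_on S"
  by (induction rule: free_rel.induct) auto

lemma equiv_free_rel: "equiv (words_on S) (free_rel S)"
proof (rule equivI)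
  show "free_rel S \<subseteq> words_on S \<times> words_on S"
    using free_rel_words by fastforce
  show "refl_on (words_on S) (free_rel S)"
    using free_rel_words by (force intro: refl_onI free_rel.refl)
  show "sym (free_rel S)"
    by (auto intro: symI free_rel.sym)
  show "trans (free_rel S)"
    by (auto intro: transI free_rel.trans)
qed

lemma free_rel_append_left:
  "(u, v) \<in> free_rel S \<Longrightarrow> p \<in> words_on S \<Longrightarrow> (p @ u, p @ v) \<in> free_rel S"
proof (induction rule: free_rel.induct)
  case (cancel u v x s)
  then show ?case using free_rel.cancel[of "p @ u" S v x s] by simp
qed (auto intro: free_rel.refl free_rel.sym free_rel.trans)

lemma free_rel_append_right:
  "(u, v) \<in> free_rel S \<Longrightarrow> p \<in> words_on S \<Longrightarrow> (u @ p, v @ p) \<in> free_rel S"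
proof (induction rule: free_rel.induct)
  case (cancel u v x s)
  then show ?case using free_rel.cancel[of u S "v @ p" x s] by simp
qed (auto intro: free_rel.refl free_rel.sym free_rel.trans)

lemma free_rel_append:
  assumes "(u, u') \<in> free_rel S" "(v, v') \<in> free_rel S"
  shows "(u @ v, u' @ v') \<in> free_rel S"
  by (meson assms free_rel.trans free_rel_append_left free_rel_append_right free_rel_words)

lemma free_rel_inverse: "w \<in> words_on S \<Longrightarrow> (inverse_word w @ w, []) \<in> free_rel S"
proof (induction w)
  case Nil
  then show ?case by (simp add: free_rel.refl)
next
  case (Cons a w)
  obtain s x where a: "a = (s, x)" by (cases a)
  have "(inverse_word w @ [(\<not> s, x), (\<not> \<not> s, x)] @ w, inverse_word w @ w) \<in> free_rel S"
    using Cons.prems a by (intro free_rel.cancel) auto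
  then show ?case using Cons a free_rel.trans by fastforce
qed

lemma free_group_mult_class:
  assumes "u \<in> words_on S" "v \<in> words_on S"
  shows "free_rel S `` {u} \<otimes>\<^bsub>free_group S\<^esub> free_rel S `` {v} = free_rel S `` {u @ v}"
proof -
  have "free_rel S `` {u' @ v'} = free_rel S `` {u @ v}"
    if "(u, u') \<in> free_rel S" "(v, v') \<in> free_rel S" for u' v'
    using equiv_class_eq[OF equiv_free_rel free_rel_append[OF that]] by simp
  then have "(\<Union>u'\<in>free_rel S `` {u}. \<Union>v'\<in>free_rel S `` {v}. free_rel S `` {u' @ v'})
      = (\<Union>u'\<in>free_rel S `` {u}. \<Union>v'\<in>free_rel S `` {v}. free_rel S `` {u @ v})"
    by (intro SUP_cong) simp_all
  also have "\<dots> = free_rel S `` {u @ v}"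
    using assms free_rel.refl[of u S] free_rel.refl[of v S] by blast
  finally show ?thesis
    by (simp add: free_group_def)
qed

lemma group_free_group: "group (free_group S)"
proof (rule groupI)
  have car: "\<exists>w\<in>words_on S. A = free_rel S `` {w}" if "A \<in> carrier (free_group S)" for A
    using that by (auto simp: free_group_def quotient_def)
  have cls: "free_rel S `` {w} \<in> carrier (free_group S)" if "w \<in> words_on S" for w
    using that by (simp add: free_group_def quotientI)
  have one: "\<one>\<^bsub>free_group S\<^esub> = free_rel S `` {[]}"
    by (simp add: free_group_def)
  show "\<one>\<^bsub>free_group S\<^esub> \<in> carrier (free_group S)"
    by (simp add: one cls)
  fix A assume "A \<in> carrier (free_group S)"
  then obtain u where u: "u \<in> words_on S" "A = free_rel S `` {u}"
    using car by blast
  show "\<one>\<^bsub>free_group S\<^esub> \<otimes>\<^bsub>free_group S\<^esub> A = A"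
    using free_group_mult_class[of "[]" S u] u one by simp
  have "free_rel S `` {inverse_word u} \<otimes>\<^bsub>free_group S\<^esub> A = \<one>\<^bsub>free_group S\<^esub>"
    using u one free_group_mult_class[of "inverse_word u" S u]
      equiv_class_eq[OF equiv_free_rel free_rel_inverse] by simp
  then show "\<exists>B\<in>carrier (free_group S). B \<otimes>\<^bsub>free_group S\<^esub> A = \<one>\<^bsub>free_group S\<^esub>"
    using u cls inverse_word_in by blast
  fix B assume "B \<in> carrier (free_group S)"
  then obtain v where v: "v \<in> words_on S" "B = free_rel S `` {v}"
    using car by blast
  show "A \<otimes>\<^bsub>free_group S\<^esub> B \<in> carrier (free_group S)"
    using u v by (simp add: free_group_mult_class cls)
  fix C assume "C \<in> carrier (free_group S)"
  then obtain w where w: "w \<in> words_on S" "C = free_rel S `` {w}"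
    using car by blast
  show "A \<otimes>\<^bsub>free_group S\<^esub> B \<otimes>\<^bsub>free_group S\<^esub> C = A \<otimes>\<^bsub>free_group S\<^esub> (B \<otimes>\<^bsub>free_group S\<^esub> C)"
    using u v w by (simp add: free_group_mult_class)
qed

definition normal_closure :: "('a, 'b) monoid_scheme \<Rightarrow> 'a set \<Rightarrow> 'a set"
  where "normal_closure G R = \<Inter>{N. N \<lhd> G \<and> R \<subseteq> N}"

definition finitely_presentable :: "('a, 'b) monoid_scheme \<Rightarrow> bool"
  where "finitely_presentable G \<longleftrightarrow>
    (\<exists>(n::nat) R. finite R \<and> R \<subseteq> carrier (free_group {..<n}) \<and>
       G \<cong> free_group {..<n} Mod normal_closure (free_group {..<n}) R)"

text \<open>
  The class \<^class>\<open>group_add\<close> does not assume commutativity: the group operation \<open>g h\<close> is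
  written \<open>g + h\<close>, the inverse \<open>- g\<close> and the neutral element \<open>0\<close>. This is the convention of
  \<^theory>\<open>HOL-Library.Poly_Mapping\<close>, whose multiplication on \<open>'g \<Rightarrow>\<^sub>0 complex\<close> is the
  convolution product, i.e. that of the group algebra. The same group as an object with a carrier:
\<close>

definition type_group :: "'g::group_add itself \<Rightarrow> 'g monoid"
  where "type_group _ = \<lparr>carrier = UNIV, mult = (+), one = 0\<rparr>"

lemma group_type_group: "group (type_group TYPE('g::group_add))"
proof (rule groupI)
  fix x :: 'g
  assume "x \<in> carrier (type_group TYPE('g))"
  show "\<exists>y\<in>carrier (type_group TYPE('g)).
      y \<otimes>\<^bsub>type_group TYPE('g)\<^esub> x = \<one>\<^bsub>type_group TYPE('g)\<^esub>"
    by (rule bexI[of _ "- x"]) (simp_all add: type_group_def)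
qed (simp_all add: type_group_def add.assoc)


section \<open>The group algebra, linear operators and derivations\<close>

type_synonym 'g group_algebra = "'g \<Rightarrow>\<^sub>0 complex"

definition algebra_scale :: "complex \<Rightarrow> 'g group_algebra \<Rightarrow> 'g group_algebra"
  where "algebra_scale c u = Poly_Mapping.map ((*) c) u"

lemma lookup_scale [simp]: "Poly_Mapping.lookup (algebra_scale c u) g = c * Poly_Mapping.lookup u g"
  by (simp add: algebra_scale_def Poly_Mapping.map.rep_eq when_def)

lemma vector_space_scale: "vector_space algebra_scale"
  by unfold_locales (rule poly_mapping_eqI, simp add: lookup_add algebra_simps)+

abbreviation linear_operator :: "('g group_algebra \<Rightarrow> 'g group_algebra) \<Rightarrow> bool"
  where "linear_operator \<equiv> Vector_Spaces.linear algebra_scale algebra_scale"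

definition derivation :: "('g::group_add group_algebra \<Rightarrow> 'g group_algebra) \<Rightarrow> bool"
  where "derivation X \<longleftrightarrow> linear_operator X \<and> (\<forall>u v. X (u * v) = X u * v + u * X v)"

abbreviation basis_elt :: "'g \<Rightarrow> 'g group_algebra"
  where "basis_elt g \<equiv> Poly_Mapping.single g 1"

definition matrix_coeff :: "('g group_algebra \<Rightarrow> 'g group_algebra) \<Rightarrow> 'g \<Rightarrow> 'g \<Rightarrow> complex"
  where "matrix_coeff X h g = Poly_Mapping.lookup (X (basis_elt g)) h"

lemma matrix_coeff_expansion:
  "finite {h. matrix_coeff X h g \<noteq> 0}"
  "X (basis_elt g) = (\<Sum>h | matrix_coeff X h g \<noteq> 0. algebra_scale (matrix_coeff X h g) (basis_elt h))"
proof -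
  show fin: "finite {h. matrix_coeff X h g \<noteq> 0}"
    by (simp add: matrix_coeff_def)
  show "X (basis_elt g) = (\<Sum>h | matrix_coeff X h g \<noteq> 0. algebra_scale (matrix_coeff X h g) (basis_elt h))"
  proof (rule poly_mapping_eqI)
    fix k
    have "Poly_Mapping.lookup (\<Sum>h | matrix_coeff X h g \<noteq> 0. algebra_scale (matrix_coeff X h g) (basis_elt h)) k
      = (\<Sum>h | matrix_coeff X h g \<noteq> 0. if h = k then matrix_coeff X h g else 0)"
      by (auto simp: lookup_sum lookup_single when_def intro!: sum.cong)
    also have "\<dots> = Poly_Mapping.lookup (X (basis_elt g)) k"
      using fin by (simp add: sum.delta) (simp add: matrix_coeff_def)
    finally show "Poly_Mapping.lookup (X (basis_elt g)) k
      = Poly_Mapping.lookup (\<Sum>h | matrix_coeff X h g \<noteq> 0. algebra_scale (matrix_coeff X h g) (basis_elt h)) k" ..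
  qed
qed


section \<open>The groupoid of the adjoint action\<close>

datatype 'g morphism = Morphism (source: 'g) (target: 'g) (label: 'g)

definition Mor :: "'g::group_add \<Rightarrow> 'g \<Rightarrow> 'g morphism set"
  where "Mor a b = {Morphism a b g | g. g + a = b + g}"

definition Morphisms :: "'g::group_add morphism set"
  where "Morphisms = (\<Union>a b. Mor a b)"

text \<open>Composition \<open>\<eta> * \<xi>\<close>, meaningful only if \<open>target \<xi> = source \<eta>\<close>.\<close>

definition mor_comp :: "'g::group_add morphism \<Rightarrow> 'g morphism \<Rightarrow> 'g morphism"
  where "mor_comp \<eta> \<xi> = Morphism (source \<xi>) (target \<eta>) (label \<eta> + label \<xi>)"

lemma mor_comp_in_Mor: "\<xi> \<in> Mor a b \<Longrightarrow> \<eta> \<in> Mor b c \<Longrightarrow> mor_comp \<eta> \<xi> \<in> Mor a c"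
  by (auto simp: Mor_def mor_comp_def add.assoc) (simp flip: add.assoc)

text \<open>On \<open>Mor a b\<close>, \<open>label \<xi> + source \<xi>\<close> equals \<open>target \<xi> + label \<xi>\<close>.\<close>

definition assoc_fun ::
    "('g::group_add group_algebra \<Rightarrow> 'g group_algebra) \<Rightarrow> 'g morphism \<Rightarrow> complex"
  where "assoc_fun X \<xi> = matrix_coeff X (label \<xi> + source \<xi>) (label \<xi>)"

end

(*
  Both sides of the Leibniz rule are bilinear, so it suffices to test it on pairs of basis elements
  g2, g1. Comparing the coefficients at h = g2 g1 a gives exactly the additivity of the associated
  function on the composable pair with labels g1 : a -> b and g2 : b -> c, and every triple
  (g2, g1, h) arises in this way.
*)
theory Submission
  imports Defs
begin

text \<open>Inserting a fresh key into a finitely supported map amounts to adding a monomial, so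
  additive identities need checking on monomials only.\<close>

lemma poly_mapping_single_add_induct [case_names single add]:
  fixes u :: "'a \<Rightarrow>\<^sub>0 'b::monoid_add"
  assumes single: "\<And>a b. P (Poly_Mapping.single a b)"
    and add: "\<And>u v. P u \<Longrightarrow> P v \<Longrightarrow> P (u + v)"
  shows "P u"
proof (induction u rule: update_induct)
  case const
  show ?case
    \<comment> \<open>The zero map is the monomial with coefficient 0 at any key, so it needs no
      case of its own.\<close>
    using single[of undefined 0] by simp
next
  case (update u a b)
  have "Poly_Mapping.update a b u = Poly_Mapping.single a b + u"
    using update(1)
    by (intro poly_mapping_eqI) (auto simp: lookup_update lookup_add lookup_single in_keys_iff when_def)
  then show ?case
    using add[OF single update(3)] by simp
qed

text \<open>Variant suited to linear operators: with the scalar split off, linearity leaves only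
  values at basis elements.\<close>

lemma poly_mapping_scaled_basis_induct [case_names scaled_basis add]:
  assumes "\<And>c g. P (algebra_scale c (basis_elt g))"
    and "\<And>u v. P u \<Longrightarrow> P v \<Longrightarrow> P (u + v)"
  shows "P u"
proof (induction u rule: poly_mapping_single_add_induct)
  case (single g c)
  have "Poly_Mapping.single g c = algebra_scale c (basis_elt g)"
    by (rule poly_mapping_eqI) (simp add: lookup_single when_def)
  then show ?case
    using assms(1) by simp
qed (rule assms(2))

text \<open>Left translation by \<open>g\<close> is a bijection of the group, so only one term of
  the convolution contributes at \<open>k\<close>.\<close>

lemma lookup_basis_mult:
  fixes g k :: "'g::group_add"
  shows "Poly_Mapping.lookup (basis_elt g * u) k = Poly_Mapping.lookup u (- g + k)"
proof (induction u rule: poly_mapping_single_add_induct)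
  case (single h c)
  have "g + h = k \<longleftrightarrow> h = - g + k"
    by (auto simp flip: add.assoc)
  then show ?case
    by (simp add: mult_single lookup_single when_def)
qed (simp add: distrib_left lookup_add)

lemma lookup_mult_basis:
  fixes g k :: "'g::group_add"
  shows "Poly_Mapping.lookup (u * basis_elt g) k = Poly_Mapping.lookup u (k - g)"
proof (induction u rule: poly_mapping_single_add_induct)
  case (single h c)
  have "h + g = k \<longleftrightarrow> h = k - g"
    by (simp add: eq_diff_eq)
  then show ?case
    by (simp add: mult_single lookup_single when_def)
qed (simp add: distrib_right lookup_add)

lemma algebra_scale_add: "algebra_scale c (u + v) = algebra_scale c u + algebra_scale c v"
  by (rule vector_space.vector_space_assms(1)[OF vector_space_scale])

text \<open>Scalars embed as multiples of the unit; since these are central, moving scalars through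
  products reduces to associativity.\<close>

lemma algebra_scale_eq_mult:
  fixes u :: "'g::group_add group_algebra"
  shows "algebra_scale c u = Poly_Mapping.single 0 c * u"
proof (induction u rule: poly_mapping_single_add_induct)
  case (single h d)
  show ?case
    by (rule poly_mapping_eqI) (simp add: mult_single lookup_single when_def)
next
  case (add u v)
  then show ?case
    by (simp add: algebra_scale_add distrib_left)
qed

lemma single_0_mult_commute:
  fixes u :: "'g::group_add \<Rightarrow>\<^sub>0 complex"
  shows "u * Poly_Mapping.single 0 c = Poly_Mapping.single 0 c * u"
  by (induction u rule: poly_mapping_single_add_induct)
    (simp_all add: mult_single mult.commute distrib_left distrib_right)

lemma algebra_scale_mult_left:
  fixes u v :: "'g::group_add group_algebra"
  shows "algebra_scale c u * v = algebra_scale c (u * v)"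
  by (simp add: algebra_scale_eq_mult mult.assoc)

lemma algebra_scale_mult_right:
  fixes u v :: "'g::group_add group_algebra"
  shows "u * algebra_scale c v = algebra_scale c (u * v)"
  by (simp add: algebra_scale_eq_mult single_0_mult_commute flip: mult.assoc)

text \<open>The Leibniz rule is extended from basis pairs one argument at a time.\<close>

lemma derivation_iff_basis:
  fixes X :: "'g::group_add group_algebra \<Rightarrow> 'g group_algebra"
  assumes "linear_operator X"
  shows "derivation X \<longleftrightarrow>
    (\<forall>g h. X (basis_elt (g + h)) = X (basis_elt g) * basis_elt h + basis_elt g * X (basis_elt h))"
    (is "_ \<longleftrightarrow> ?B")
proof
  assume "derivation X"
  then have "X (basis_elt g * basis_elt h) = X (basis_elt g) * basis_elt h + basis_elt g * X (basis_elt h)"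
    for g h
    by (simp add: derivation_def)
  then show ?B
    by (simp add: mult_single)
next
  interpret Vector_Spaces.linear algebra_scale algebra_scale X
    by (rule assms)
  \<comment> \<open>Inside the inductions \<open>add\<close> names a case, so additivity of
    \<open>X\<close> is saved under another name.\<close>
  note X_add = add
  assume B: ?B
  \<comment> \<open>The second argument becomes arbitrary first; this is then the base case of the
    induction on the first.\<close>
  have left: "X (basis_elt g * v) = X (basis_elt g) * v + basis_elt g * X v" for g v
  proof (induction v rule: poly_mapping_scaled_basis_induct)
    case (scaled_basis c h)
    show ?case
      using B by (simp add: scale algebra_scale_mult_right mult_single algebra_scale_add)
  next
    case (add v w)
    then show ?case
      by (simp add: add X_add distrib_left)
  qed
  have "X (u * v) = X u * v + u * X v" for u v
  proof (induction u rule: poly_mapping_scaled_basis_induct)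
    case (scaled_basis c h)
    show ?case
      by (simp add: scale algebra_scale_mult_left left algebra_scale_add)
  next
    case (add u w)
    then show ?case
      by (simp add: add X_add distrib_right)
  qed
  then show "derivation X"
    using assms by (simp add: derivation_def)
qed

lemma derivation_iff_matrix_coeff:
  fixes X :: "'g::group_add group_algebra \<Rightarrow> 'g group_algebra"
  assumes "linear_operator X"
  shows "derivation X \<longleftrightarrow>
    (\<forall>g h k. matrix_coeff X k (g + h) = matrix_coeff X (k - h) g + matrix_coeff X (- g + k) h)"
  by (simp add: derivation_iff_basis[OF assms] poly_mapping_eq_iff fun_eq_iff lookup_add
      lookup_basis_mult lookup_mult_basis matrix_coeff_def)

theorem theorem1:
  fixes X :: "'g::group_add group_algebra \<Rightarrow> 'g group_algebra"
  assumes "finitely_presentable (type_group TYPE('g))"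
    and "linear_operator X"
  shows "derivation X \<longleftrightarrow>
    (\<forall>\<xi>\<in>Morphisms. \<forall>\<eta>\<in>Morphisms. target \<xi> = source \<eta> \<longrightarrow>
       assoc_fun X (mor_comp \<eta> \<xi>) = assoc_fun X \<eta> + assoc_fun X \<xi>)"
    (is "_ \<longleftrightarrow> ?T")
proof
  assume "derivation X"
  then have coeff: "matrix_coeff X k (g + h) = matrix_coeff X (k - h) g + matrix_coeff X (- g + k) h"
    for g h k
    using derivation_iff_matrix_coeff[OF assms(2)] by blast
  have "assoc_fun X (mor_comp (Morphism b c g) (Morphism a b h))
      = assoc_fun X (Morphism b c g) + assoc_fun X (Morphism a b h)"
    if h: "h + a = b + h" for a b c g h
  proof -
    \<comment> \<open>At \<open>k = g + h + a\<close>, the shifted indices \<open>k - h\<close> and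
      \<open>- g + k\<close> are label plus source of the two morphisms.\<close>
    have "g + h + a - h = g + b"
      using h by (simp add: add.assoc diff_eq_eq)
    moreover have "- g + (g + h + a) = h + a"
      by (simp add: add.assoc)
    ultimately show ?thesis
      using coeff[of "g + h + a" g h] by (simp add: assoc_fun_def mor_comp_def)
  qed
  then show ?T
    by (auto simp: Morphisms_def Mor_def)
next
  assume T: ?T
  have "matrix_coeff X k (g + h) = matrix_coeff X (k - h) g + matrix_coeff X (- g + k) h" for g h k
  proof -
    \<comment> \<open>This solves \<open>g + h + a = k\<close> for the source; \<open>b\<close> is
      then its conjugate by \<open>h\<close>, the only possible target of a morphism from
      \<open>a\<close> with label \<open>h\<close>.\<close>
    define a where "a = - h + (- g + k)"
    define b where "b = h + a - h"
    have ha: "h + a = - g + k"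
      unfolding a_def by (rule add_minus_cancel)
    then have k: "g + h + a = k"
      by (simp add: add.assoc)
    have gb: "g + b = k - h"
      using k by (simp add: b_def add_diff_eq add.assoc)
    have "Morphism a b h \<in> Morphisms" "Morphism b (g + b - g) g \<in> Morphisms"
      by (auto simp: Morphisms_def Mor_def b_def)
    with T have "assoc_fun X (mor_comp (Morphism b (g + b - g) g) (Morphism a b h))
        = assoc_fun X (Morphism b (g + b - g) g) + assoc_fun X (Morphism a b h)"
      by force
    then show ?thesis
      by (simp add: assoc_fun_def mor_comp_def k gb ha)
  qed
  then show "derivation X"
    using derivation_iff_matrix_coeff[OF assms(2)] by blast
qed

end
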